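(* Let $f\colon 2^N\to\mathbb{R}_{\ge0}$ be monotone submodular with $|N|=n$, let $k\le n$ and $\varepsilon\in(0,1/2)$. Set $\eta=\varepsilon/4$ and \[ \mathcal{K}=\{1,\dots,\min\{k,\lceil1/\eta\rceil\}\}\cup\{\min\{k,\lceil(1+\eta)^j\rceil\}: j=0,1,\dots,\lceil\log_{1+\eta}k\rceil\}, \] and let $P=\bigcup_{q\in\mathcal{K}}S_q$ with $S_q=\textsc{ThresholdGreedy}(N,f,q,\eta)$. Then $|P|=O(k/\varepsilon)$, the construction uses $\tilde O(n/\varepsilon^2)$ value queries, and for every $k'\le k$ there exists $Q\subseteq P$ with $|Q|\le k'$ and $f(Q)\ge(1-1/e-\varepsilon)\mathrm{OPT}_{k'}$.
   Context: $\mathrm{OPT}_{q}=\max_{|S|\le q}f(S)$. $\textsc{ThresholdGreedy}(N,f,q,\eta)$ is the decreasing-threshold greedy algorithm of Badanidiyuru and Vondrák, which for monotone submodular $f$ returns $S$ with $|S|\le q$ and $f(S)\ge(1-1/e-\eta)\mathrm{OPT}_q$ using $O((n/\eta)\log(n/\eta))$ value queries. $\tilde O$ hides logarithmic factors. *)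

theory Defs
  imports Complex_Main
begin

definition submodular_on :: "'a set \<Rightarrow> ('a set \<Rightarrow> real) \<Rightarrow> bool" where
  "submodular_on N f \<longleftrightarrow>
     (\<forall>A B. A \<subseteq> N \<longrightarrow> B \<subseteq> N \<longrightarrow> f (A \<union> B) + f (A \<inter> B) \<le> f A + f B)"

definition OPT :: "'a set \<Rightarrow> ('a set \<Rightarrow> real) \<Rightarrow> nat \<Rightarrow> real" where
  "OPT N f q = Max (f ` {S. S \<subseteq> N \<and> card S \<le> q})"

text \<open>
  Algorithms in the value-oracle model: a program can learn about the set function only
  through its \<open>Query\<close> nodes, so that counting these along an execution counts value queries.
\<close>

datatype ('a, 'r) prog = Return 'r | Query "'a set" "real \<Rightarrow> ('a, 'r) prog"

primrec result :: "('a set \<Rightarrow> real) \<Rightarrow> ('a, 'r) prog \<Rightarrow> 'r" where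
  "result f (Return r) = r"
| "result f (Query A c) = result f (c (f A))"

primrec queries :: "('a set \<Rightarrow> real) \<Rightarrow> ('a, 'r) prog \<Rightarrow> nat" where
  "queries f (Return r) = 0"
| "queries f (Query A c) = Suc (queries f (c (f A)))"

primrec andthen :: "('a, 'r) prog \<Rightarrow> ('r \<Rightarrow> ('a, 's) prog) \<Rightarrow> ('a, 's) prog" where
  "andthen (Return r) g = g r"
| "andthen (Query A c) g = Query A (\<lambda>v. andthen (c v) g)"

primrec for_each :: "'e list \<Rightarrow> ('e \<Rightarrow> 's \<Rightarrow> ('a, 's) prog) \<Rightarrow> 's \<Rightarrow> ('a, 's) prog" where
  "for_each [] body s = Return s"
| "for_each (e # es) body s = andthen (body e s) (for_each es body)"

primrec query_all :: "'a set list \<Rightarrow> ('a, real list) prog" where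
  "query_all [] = Return []"
| "query_all (A # As) = Query A (\<lambda>v. andthen (query_all As) (\<lambda>vs. Return (v # vs)))"

definition threshold_step :: "nat \<Rightarrow> real \<Rightarrow> 'a \<Rightarrow> 'a set \<Rightarrow> ('a, 'a set) prog" where
  "threshold_step q w e S =
     (if card (insert e S) \<le> q
      then Query (insert e S) (\<lambda>a. Query S (\<lambda>b.
             Return (if a - b \<ge> w then insert e S else S)))
      else Return S)"

text \<open>
  The decreasing-threshold greedy algorithm of Badanidiyuru and Vondrak on a ground set
  enumerated (in an arbitrary order) by \<open>xs\<close>, with \<open>n = length xs\<close>:

  \<^verbatim>\<open>S := {};  d := max {f {e} | e};
  for (w := d; w >= (eta / n) * d; w := (1 - eta) * w)
    for all e:  if |S + e| <= q and f (S + e) - f S >= w then S := S + e;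
  return S\<close>

  The thresholds are \<open>w = d * (1 - \<eta>) ^ i\<close>; dividing the loop guard by \<open>d\<close> leaves
  \<open>(1 - \<eta>) ^ i \<ge> \<eta> / n\<close>, so the number of passes is the first \<open>i\<close> violating it.  For
  \<open>d > 0\<close> this is exactly the loop above; for \<open>d = 0\<close> (where the loop taken literally would
  not terminate) it performs the same number of passes.
\<close>

definition num_passes :: "nat \<Rightarrow> real \<Rightarrow> nat" where
  "num_passes n \<eta> = (LEAST i. (1 - \<eta>) ^ i < \<eta> / real n)"

definition threshold_greedy :: "'a list \<Rightarrow> nat \<Rightarrow> real \<Rightarrow> ('a, 'a set) prog" where
  "threshold_greedy xs q \<eta> =
     andthen (query_all (map (\<lambda>e. {e}) xs)) (\<lambda>vs.
       for_each [0..<num_passes (length xs) \<eta>]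
         (\<lambda>i. for_each xs (threshold_step q (Max (set vs) * (1 - \<eta>) ^ i))) {})"

definition size_grid :: "nat \<Rightarrow> real \<Rightarrow> nat set" where
  "size_grid k \<eta> =
     {1..min k (nat \<lceil>1 / \<eta>\<rceil>)} \<union>
     (\<lambda>j. min k (nat \<lceil>(1 + \<eta>) ^ j\<rceil>)) ` {0..nat \<lceil>log (1 + \<eta>) (real k)\<rceil>}"

end

theory Submission
  imports Defs
begin

text \<open>
  The grid contains, for every \<open>1 \<le> m \<le> k\<close>, a budget \<open>q \<le> m \<le> (1 + \<eta>) q\<close>, and
  the output for budget \<open>q\<close> is compared directly with an optimal set \<open>O\<close> of size \<open>m\<close>.  When a
  pass with threshold \<open>w\<close> starts, every marginal value is at most \<open>w / (1 - \<eta>)\<close>, so that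
  \<open>f O - f S \<le> m w / (1 - \<eta>)\<close> by submodularity, and each inserted element shrinks the gap
  \<open>f O - f S\<close> by the factor \<open>1 - (1 - \<eta>) / m\<close>.  If \<open>q\<close> elements are inserted, the gap is at
  most \<open>exp (- (1 - \<eta>) / (1 + \<eta>)) f O\<close>; otherwise all marginal values have dropped below
  \<open>\<eta> d / ((1 - \<eta>) n)\<close>, where \<open>d \<le> f O\<close> is the largest singleton value.
\<close>

section \<open>Programs\<close>

lemma result_andthen: "result f (andthen p g) = result f (g (result f p))"
  by (induction p) auto

lemma queries_andthen:
  "queries f (andthen p g) = queries f p + queries f (g (result f p))"
  by (induction p) auto

lemma result_query_all: "result f (query_all As) = map f As"
  by (induction As) (auto simp: result_andthen)

lemma queries_query_all: "queries f (query_all As) = length As"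
  by (induction As) (auto simp: queries_andthen)

lemma queries_for_each_le:
  assumes "\<And>e s. queries f (body e s) \<le> b"
  shows "queries f (for_each es body s) \<le> length es * b"
proof (induction es arbitrary: s)
  case (Cons e es)
  show ?case
    using add_mono[OF assms[of e s] Cons[of "result f (body e s)"]]
    by (simp add: queries_andthen)
qed simp

text \<open>One query per singleton for the maximum, then at most two per element and pass, for
  \<open>insert e S\<close> and \<open>S\<close>.\<close>

lemma queries_threshold_greedy_le:
  "queries f (threshold_greedy xs q \<eta>)
     \<le> length xs + num_passes (length xs) \<eta> * (length xs * 2)"
proof -
  have step: "queries f (threshold_step q w e S) \<le> 2" for w e S
    by (simp add: threshold_step_def)
  have "queries f (for_each [0..<num_passes (length xs) \<eta>]
          (\<lambda>i. for_each xs (threshold_step q (v i))) {})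
        \<le> length [0..<num_passes (length xs) \<eta>] * (length xs * 2)" for v
    by (intro queries_for_each_le step)
  then show ?thesis
    by (simp add: threshold_greedy_def queries_andthen queries_query_all)
qed

lemma result_threshold_step:
  "result f (threshold_step q w e S) =
     (if card (insert e S) \<le> q \<and> f (insert e S) - f S \<ge> w then insert e S else S)"
  by (simp add: threshold_step_def)

lemma card_threshold_greedy_le: "card (result f (threshold_greedy xs q \<eta>)) \<le> q"
proof -
  have inv: "card (result f (for_each es body S)) \<le> q"
    if "\<And>e S. card S \<le> q \<Longrightarrow> card (result f (body e S)) \<le> q" "card S \<le> q"
    for es :: "'e list" and body S
    using that(2) by (induction es arbitrary: S) (auto simp: result_andthen that(1))
  have pass: "card (result f (for_each xs (threshold_step q w) S)) \<le> q"
    if "card S \<le> q" for w S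
    using that by (induction xs arbitrary: S) (auto simp: result_andthen result_threshold_step)
  show ?thesis
    by (auto simp: threshold_greedy_def result_andthen intro!: inv pass)
qed

section \<open>The approximation guarantee\<close>

locale monotone_submodular =
  fixes N :: "'a set" and f :: "'a set \<Rightarrow> real"
  assumes finite_ground: "finite N"
    and nonneg: "A \<subseteq> N \<Longrightarrow> 0 \<le> f A"
    and mono: "mono_on (Pow N) f"
    and submodular: "submodular_on N f"
begin

section \<open>Diminishing returns\<close>

lemma value_mono: "A \<subseteq> B \<Longrightarrow> B \<subseteq> N \<Longrightarrow> f A \<le> f B"
  using mono by (auto simp: mono_on_def)

text \<open>If \<open>e \<in> B\<close>, the left side is 0 and monotonicity suffices. Otherwise
  submodularity is applied to \<open>insert e A\<close> and \<open>B\<close>, whose intersection is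
  then \<open>A\<close>.\<close>

lemma marginal_antimono:
  assumes "A \<subseteq> B" "B \<subseteq> N" "e \<in> N"
  shows "f (insert e B) - f B \<le> f (insert e A) - f A"
proof (cases "e \<in> B")
  case True
  then show ?thesis
    using value_mono[of A "insert e A"] assms by (auto simp: insert_absorb)
next
  case False
  then have "insert e A \<union> B = insert e B" "insert e A \<inter> B = A"
    using assms by auto
  moreover have "f (insert e A \<union> B) + f (insert e A \<inter> B) \<le> f (insert e A) + f B"
    using submodular[unfolded submodular_on_def, rule_format, of "insert e A" B] assms by simp
  ultimately show ?thesis by simp
qed

lemma union_le_sum_marginals:
  assumes "S \<subseteq> N" "O' \<subseteq> N"
  shows "f (S \<union> O') - f S \<le> (\<Sum>e\<in>O'. f (insert e S) - f S)"
proof -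
  have "finite O'" using assms finite_ground finite_subset by blast
  then show ?thesis using assms(2)
  proof induction
    case (insert e O')
    have "f (insert e (S \<union> O')) - f (S \<union> O') \<le> f (insert e S) - f S"
      using insert assms by (intro marginal_antimono) auto
    with insert show ?case by simp
  qed simp
qed

text \<open>Conditional on \<open>card S < q\<close>: once the budget is exhausted, elements are
  rejected for size, which says nothing about their marginal values.\<close>

definition marginals_le :: "nat \<Rightarrow> real \<Rightarrow> 'a set \<Rightarrow> bool" where
  "marginals_le q w S \<longleftrightarrow>
     (card S < q \<longrightarrow> (\<forall>e\<in>N. f (insert e S) - f S \<le> w))"

lemma marginals_le_superset:
  assumes "marginals_le q w A" "A \<subseteq> B" "B \<subseteq> N"
  shows "marginals_le q w B"
  unfolding marginals_le_def
proof (intro impI ballI)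
  fix e assume *: "card B < q" "e \<in> N"
  have "card A \<le> card B" using assms finite_ground by (metis card_mono finite_subset)
  with * assms have "f (insert e A) - f A \<le> w" by (auto simp: marginals_le_def)
  with marginal_antimono[of A B e] assms * show "f (insert e B) - f B \<le> w" by simp
qed

text \<open>By monotonicity \<open>f O' \<le> f (S \<union> O')\<close>, and the union gains over
  \<open>S\<close> at most \<open>card O'\<close> marginal values, each at most
  \<open>w\<close>.\<close>

lemma gap_le:
  assumes "marginals_le q w S" "card S < q" "S \<subseteq> N" "O' \<subseteq> N" "card O' \<le> m" "0 \<le> w"
  shows "f O' - f S \<le> real m * w"
proof -
  have "f O' \<le> f (S \<union> O')" using assms by (intro value_mono) auto
  then have "f O' - f S \<le> (\<Sum>e\<in>O'. f (insert e S) - f S)"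
    using union_le_sum_marginals[of S O'] assms by simp
  also have "\<dots> \<le> real (card O') * w"
    using assms by (intro sum_bounded_above) (auto simp: marginals_le_def)
  also have "\<dots> \<le> real m * w"
    using assms by (intro mult_right_mono) auto
  finally show ?thesis .
qed

text \<open>The power records one contraction of the gap per inserted element; \<open>r\<close> will
  be \<open>1 - (1 - \<eta>) / m\<close>.\<close>

definition gap_invariant :: "nat \<Rightarrow> real \<Rightarrow> 'a set \<Rightarrow> 'a set \<Rightarrow> bool" where
  "gap_invariant q r O' S \<longleftrightarrow>
     S \<subseteq> N \<and> card S \<le> q \<and> f O' - f S \<le> r ^ card S * f O'"

lemma threshold_step_gap:
  assumes inv: "gap_invariant q (1 - (1 - \<eta>) / real m) O' S"
    and marg: "marginals_le q (w / (1 - \<eta>)) S"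
    and O': "O' \<subseteq> N" "card O' \<le> m" "0 < m"
    and \<eta>: "0 < \<eta>" "\<eta> < 1" and w: "0 \<le> w" and e: "e \<in> N"
  shows "gap_invariant q (1 - (1 - \<eta>) / real m) O' (result f (threshold_step q w e S))"
\<comment> \<open>For \<open>w = 0\<close> an element of \<open>S\<close> passes the test without
  enlarging \<open>S\<close>; \<open>e \<notin> S\<close> sends that case to the branch where
  nothing changes.\<close>
proof (cases "card (insert e S) \<le> q \<and> f (insert e S) - f S \<ge> w \<and> e \<notin> S")
  case True
  let ?r = "1 - (1 - \<eta>) / real m"
  have S: "S \<subseteq> N" and gap: "f O' - f S \<le> ?r ^ card S * f O'"
    using inv by (auto simp: gap_invariant_def)
  have "finite S" using S finite_ground finite_subset by blast
  with True have card: "card (insert e S) = Suc (card S)" by simp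
  have r: "0 \<le> ?r" using O' \<eta> by (simp add: field_simps)
  have "f O' - f S \<le> real m * (w / (1 - \<eta>))"
    using True card assms S by (intro gap_le) auto
  then have "(1 - \<eta>) / real m * (f O' - f S) \<le> w"
    using O' \<eta> by (simp add: field_simps)
  then have "f O' - f (insert e S) \<le> ?r * (f O' - f S)"
    using True by (simp add: left_diff_distrib)
  also have "\<dots> \<le> ?r * (?r ^ card S * f O')"
    using gap r by (intro mult_left_mono)
  finally show ?thesis
    using True S e card by (simp add: gap_invariant_def result_threshold_step)
next
  case False
  then have "result f (threshold_step q w e S) = S"
    by (auto simp: result_threshold_step)
  with inv show ?thesis by simp
qed

text \<open>The bound \<open>w / (1 - \<eta>)\<close> survives the whole pass because the set only
  grows. An element rejected for its value has marginal value below \<open>w\<close> then, hence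
  also at \<open>R\<close>; \<open>S \<subseteq> R\<close> is carried along for this
  comparison.\<close>

lemma threshold_pass:
  assumes "set es \<subseteq> N"
    and "gap_invariant q (1 - (1 - \<eta>) / real m) O' S"
    and "marginals_le q (w / (1 - \<eta>)) S"
    and O': "O' \<subseteq> N" "card O' \<le> m" "0 < m"
    and \<eta>: "0 < \<eta>" "\<eta> < 1" and w: "0 \<le> w"
  defines "R \<equiv> result f (for_each es (threshold_step q w) S)"
  shows "gap_invariant q (1 - (1 - \<eta>) / real m) O' R \<and> S \<subseteq> R \<and>
    (card R < q \<longrightarrow> (\<forall>e\<in>set es. f (insert e R) - f R \<le> w))"
  using assms(1-3) unfolding R_def
proof (induction es arbitrary: S)
  case (Cons e es)
  let ?S = "result f (threshold_step q w e S)"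
  let ?R = "result f (for_each es (threshold_step q w) ?S)"
  have e: "e \<in> N" and S: "S \<subseteq> N"
    using Cons.prems by (auto simp: gap_invariant_def)
  have inv: "gap_invariant q (1 - (1 - \<eta>) / real m) O' ?S"
    using Cons.prems O' \<eta> w e by (intro threshold_step_gap)
  have sub: "S \<subseteq> ?S" "?S \<subseteq> N"
    using e S by (auto simp: result_threshold_step)
  have "marginals_le q (w / (1 - \<eta>)) ?S"
    using marginals_le_superset[OF Cons.prems(3) sub] .
  from Cons.IH[OF _ inv this] Cons.prems
  have IH: "gap_invariant q (1 - (1 - \<eta>) / real m) O' ?R" "?S \<subseteq> ?R"
    "card ?R < q \<longrightarrow> (\<forall>e\<in>set es. f (insert e ?R) - f ?R \<le> w)"
    by auto
  have R: "?R \<subseteq> N" using IH by (simp add: gap_invariant_def)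
  \<comment> \<open>Room left at the end of the pass means room when \<open>e\<close> was scanned,
    so \<open>e\<close> can only have been rejected for its value.\<close>
  have "f (insert e ?R) - f ?R \<le> w" if "card ?R < q"
  proof (cases "e \<in> ?S")
    case True
    then show ?thesis using IH(2) w by (simp add: insert_absorb subset_iff)
  next
    case False
    have "card S \<le> card ?R"
      using IH(2) sub R finite_ground by (meson card_mono finite_subset subset_trans)
    with that have "card (insert e S) \<le> q"
      using card_insert_le_m1[of q S e] by linarith
    with False have "f (insert e S) - f S < w"
      by (auto simp: result_threshold_step split: if_splits)
    moreover have "f (insert e ?R) - f ?R \<le> f (insert e S) - f S"
      using IH(2) sub R e by (intro marginal_antimono) auto
    ultimately show ?thesis by simp
  qed
  then show ?case using IH sub by (auto simp: result_andthen)
qed simp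

text \<open>The marginal bound left by one pass is exactly the bound \<open>w / (1 - \<eta>)\<close>
  that the next, lower threshold requires. Dividing by \<open>1 - \<eta>\<close> instead of using
  the exponent \<open>p - 1\<close> lets the induction start at \<open>p = 0\<close>.\<close>

lemma threshold_passes:
  fixes q :: nat
  assumes xs: "set xs = N" and d: "\<And>e. e \<in> N \<Longrightarrow> f {e} \<le> d" "0 \<le> d"
    and O': "O' \<subseteq> N" "card O' \<le> m" "0 < m"
    and \<eta>: "0 < \<eta>" "\<eta> < 1"
  defines "R \<equiv> \<lambda>p. result f (for_each [0..<p]
      (\<lambda>i. for_each xs (threshold_step q (d * (1 - \<eta>) ^ i))) {})"
  shows "gap_invariant q (1 - (1 - \<eta>) / real m) O' (R p) \<and>
    marginals_le q (d * (1 - \<eta>) ^ p / (1 - \<eta>)) (R p)"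
proof (induction p)
  case 0
  have "f (insert e {}) - f {} \<le> d / (1 - \<eta>)" if "e \<in> N" for e
  proof -
    have "f (insert e {}) - f {} \<le> d"
      using d(1)[OF that] nonneg[of "{}"] by simp
    also have "d \<le> d / (1 - \<eta>)"
      using \<eta> d(2) by (simp add: field_simps)
    finally show ?thesis .
  qed
  then show ?case
    using nonneg[of "{}"] by (simp add: R_def gap_invariant_def marginals_le_def)
next
  case (Suc p)
  let ?w = "d * (1 - \<eta>) ^ p"
  have for_each_append:
    "result f (for_each (as @ [b]) body s) = result f (body b (result f (for_each as body s)))"
    for as b s and body :: "nat \<Rightarrow> 'a set \<Rightarrow> ('a, 'a set) prog"
    by (induction as arbitrary: s) (auto simp: result_andthen)
  have R: "R (Suc p) = result f (for_each xs (threshold_step q ?w) (R p))"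
    by (simp add: R_def for_each_append)
  have "0 \<le> ?w" using d \<eta> by simp
  from threshold_pass[OF _ _ _ O' \<eta> this, of xs q "R p"] Suc xs
  show ?case
    using \<eta> unfolding R marginals_le_def by simp
qed

text \<open>The arguments of \<open>max\<close> belong to the two outcomes: \<open>q\<close>
  elements inserted, or budget left over after the last pass. The hypothesis on singletons gives
  \<open>d \<le> f O'\<close>, making the leftover error a multiple of \<open>f O'\<close>.\<close>

lemma threshold_greedy_gap:
  fixes q :: nat
  assumes xs: "set xs = N" "distinct xs"
    and O': "O' \<subseteq> N" "card O' \<le> m" "0 < m" "m \<le> card N"
    and opt: "\<And>e. e \<in> N \<Longrightarrow> f {e} \<le> f O'"
    and \<eta>: "0 < \<eta>" "\<eta> < 1"
  defines "R \<equiv> result f (threshold_greedy xs q \<eta>)"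
  shows "f O' - f R \<le> max ((1 - (1 - \<eta>) / real m) ^ q) (\<eta> / (1 - \<eta>)) * f O'"
proof -
  define d where "d = Max ((\<lambda>e. f {e}) ` N)"
  define p where "p = num_passes (card N) \<eta>"
  have n: "card N > 0" "N \<noteq> {}" using O' by auto
  have d: "f {e} \<le> d" if "e \<in> N" for e
    using that finite_ground by (simp add: d_def)
  have "d \<in> (\<lambda>e. f {e}) ` N"
    unfolding d_def using n finite_ground by (intro Max_in) auto
  then have d_bounds: "0 \<le> d" "d \<le> f O'"
    using opt nonneg by auto
  have len: "length xs = card N" using xs distinct_card by force
  have R: "R = result f (for_each [0..<p]
      (\<lambda>i. for_each xs (threshold_step q (d * (1 - \<eta>) ^ i))) {})"
    using xs(1) by (simp add: R_def threshold_greedy_def result_andthen result_query_all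
      len p_def d_def image_image)
  have inv: "gap_invariant q (1 - (1 - \<eta>) / real m) O' R"
    and marg: "marginals_le q (d * (1 - \<eta>) ^ p / (1 - \<eta>)) R"
    using threshold_passes[OF xs(1) d d_bounds(1) O'(1-3) \<eta>, of q p] by (auto simp: R)
  have fO: "0 \<le> f O'" using O' nonneg by simp
  show "f O' - f R \<le> max ((1 - (1 - \<eta>) / real m) ^ q) (\<eta> / (1 - \<eta>)) * f O'"
  proof (cases "card R < q")
    case False
    with inv have "card R = q" by (simp add: gap_invariant_def)
    with inv have "f O' - f R \<le> (1 - (1 - \<eta>) / real m) ^ q * f O'"
      by (auto simp: gap_invariant_def)
    also have "\<dots> \<le> max ((1 - (1 - \<eta>) / real m) ^ q) (\<eta> / (1 - \<eta>)) * f O'"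
      using fO by (intro mult_right_mono) auto
    finally show ?thesis .
  next
    case True
    \<comment> \<open>The powers of \<open>1 - \<eta>\<close> tend to 0, so the \<open>LEAST\<close>
      in \<open>num_passes\<close> is attained.\<close>
    have "\<exists>i. (1 - \<eta>) ^ i < \<eta> / real (card N)"
      using n \<eta> by (intro real_arch_pow_inv) auto
    then have last: "(1 - \<eta>) ^ p < \<eta> / real (card N)"
      unfolding p_def num_passes_def by (rule LeastI_ex)
    have "f O' - f R \<le> real m * (d * (1 - \<eta>) ^ p / (1 - \<eta>))"
      using marg True inv O' d_bounds \<eta> by (intro gap_le) (auto simp: gap_invariant_def)
    also have "\<dots> \<le> real (card N) * (f O' * (\<eta> / real (card N)) / (1 - \<eta>))"
      using O' d_bounds \<eta> last fO by (intro mult_mono divide_right_mono) auto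
    also have "\<dots> = \<eta> / (1 - \<eta>) * f O'" using n by simp
    also have "\<dots> \<le> max ((1 - (1 - \<eta>) / real m) ^ q) (\<eta> / (1 - \<eta>)) * f O'"
      using fO by (intro mult_right_mono) auto
    finally show ?thesis .
  qed
qed

lemma OPT_attained:
  obtains O' where "O' \<subseteq> N" "card O' \<le> m" "f O' = OPT N f m"
    "\<And>S. S \<subseteq> N \<Longrightarrow> card S \<le> m \<Longrightarrow> f S \<le> f O'"
proof -
  let ?X = "{S. S \<subseteq> N \<and> card S \<le> m}"
  have fin: "finite ?X" using finite_ground by simp
  have "{} \<in> ?X" by simp
  then have "OPT N f m \<in> f ` ?X"
    unfolding OPT_def using fin by (intro Max_in) blast+
  then obtain O' where O': "O' \<in> ?X" "f O' = OPT N f m" by auto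
  moreover have "f S \<le> OPT N f m" if "S \<in> ?X" for S
    using that fin by (simp add: OPT_def)
  ultimately show thesis using that by auto
qed

end

section \<open>Numerical estimate of the gap and the approximation ratio\<close>

lemma inverse_exp_nonneg: "0 \<le> 1 / exp (x :: real)"
  by simp

text \<open>By \<open>1 - x \<le> exp (- x)\<close> the power is at most
  \<open>exp (- q * (1 - \<eta>) / m)\<close>, and \<open>m \<le> (1 + \<eta>) * q\<close> makes
  this exponent at most \<open>2 * \<eta> - 1\<close>. The allowance \<open>4 * \<eta>\<close> is
  the \<open>\<epsilon>\<close> of the theorem.\<close>

lemma gap_factor_le:
  assumes \<eta>: "0 < \<eta>" "\<eta> \<le> 1 / 8" and m: "0 < m" "real m \<le> (1 + \<eta>) * real q"
  shows "max ((1 - (1 - \<eta>) / real m) ^ q) (\<eta> / (1 - \<eta>)) \<le> 1 / exp 1 + 4 * \<eta>"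
proof -
  have "(1 - (1 - \<eta>) / real m) ^ q \<le> exp (- ((1 - \<eta>) / real m)) ^ q"
  proof (rule power_mono)
    show "1 - (1 - \<eta>) / real m \<le> exp (- ((1 - \<eta>) / real m))"
      using exp_ge_add_one_self[of "- ((1 - \<eta>) / real m)"] by simp
    show "0 \<le> 1 - (1 - \<eta>) / real m" using \<eta> m by (simp add: field_simps)
  qed
  also have "\<dots> = exp (- (real q * (1 - \<eta>) / real m))"
    by (simp flip: exp_of_nat_mult)
  also have "\<dots> \<le> exp (2 * \<eta> - 1)"
  proof -
    have "(1 - 2 * \<eta>) * real m \<le> (1 - 2 * \<eta>) * ((1 + \<eta>) * real q)"
      using m \<eta> by (intro mult_left_mono) auto
    also have "\<dots> = ((1 - 2 * \<eta>) * (1 + \<eta>)) * real q" by simp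
    also have "\<dots> \<le> (1 - \<eta>) * real q"
      using \<eta> by (intro mult_right_mono) (auto simp: algebra_simps)
    finally show ?thesis using m by (simp add: field_simps)
  qed
  also have "\<dots> = exp (2 * \<eta>) / exp 1" by (simp add: exp_diff)
  \<comment> \<open>Uses \<open>exp z \<le> 1 + 2 * z\<close> for
    \<open>0 \<le> z \<le> 1 / 2\<close>, with \<open>z = 2 * \<eta>\<close>.\<close>
  also have "\<dots> \<le> (1 + 4 * \<eta>) / exp 1"
    using \<eta> exp_bound_lemma[of "2 * \<eta>"] by (intro divide_right_mono) auto
  also have "\<dots> \<le> 1 / exp 1 + 4 * \<eta>"
  proof -
    have "4 * \<eta> / exp 1 \<le> 4 * \<eta> / 1"
      using \<eta> by (intro divide_left_mono) auto
    then show ?thesis by (simp add: add_divide_distrib)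
  qed
  finally have "(1 - (1 - \<eta>) / real m) ^ q \<le> 1 / exp 1 + 4 * \<eta>" .
  moreover have "\<eta> / (1 - \<eta>) \<le> 4 * \<eta>" using \<eta> by (simp add: field_simps)
  then have "\<eta> / (1 - \<eta>) \<le> 1 / exp 1 + 4 * \<eta>"
    using inverse_exp_nonneg[of 1] by linarith
  ultimately show ?thesis by simp
qed

text \<open>Playing budget \<open>q\<close> directly against an optimal set of size at most
  \<open>m\<close> avoids comparing optima for different sizes. As \<open>m > 0\<close>, singletons
  compete for this optimum.\<close>

lemma (in monotone_submodular) threshold_greedy_approx:
  assumes xs: "set xs = N" "distinct xs" and m: "0 < m" "m \<le> card N"
    and q: "real m \<le> (1 + \<eta>) * real q" and \<eta>: "0 < \<eta>" "\<eta> \<le> 1 / 8"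
  defines "R \<equiv> result f (threshold_greedy xs q \<eta>)"
  shows "(1 - 1 / exp 1 - 4 * \<eta>) * OPT N f m \<le> f R"
proof -
  obtain O' where O': "O' \<subseteq> N" "card O' \<le> m" and OPT: "f O' = OPT N f m"
    and opt: "\<And>S. S \<subseteq> N \<Longrightarrow> card S \<le> m \<Longrightarrow> f S \<le> f O'"
    using OPT_attained[of m] by blast
  have opt': "f {e} \<le> f O'" if "e \<in> N" for e
    using that m by (intro opt) auto
  have \<eta>1: "\<eta> < 1" using \<eta> by simp
  have "f O' - f R \<le> max ((1 - (1 - \<eta>) / real m) ^ q) (\<eta> / (1 - \<eta>)) * f O'"
    unfolding R_def using threshold_greedy_gap[OF xs O' m opt' \<eta>(1) \<eta>1] .
  also have "\<dots> \<le> (1 / exp 1 + 4 * \<eta>) * f O'"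
    using gap_factor_le[OF \<eta> m(1) q] nonneg[OF O'(1)] by (intro mult_right_mono)
  finally show "(1 - 1 / exp 1 - 4 * \<eta>) * OPT N f m \<le> f R"
    by (simp add: OPT algebra_simps)
qed

section \<open>The size grid\<close>

lemma finite_size_grid: "finite (size_grid k \<eta>)"
  by (simp add: size_grid_def)

lemma size_grid_le: "q \<in> size_grid k \<eta> \<Longrightarrow> q \<le> k"
  by (auto simp: size_grid_def)

text \<open>The witness is the largest power of \<open>1 + \<eta>\<close> not above
  \<open>m\<close>, rounded up: since \<open>m\<close> is an integer, rounding does not exceed it,
  and the next power is above \<open>m\<close>.\<close>

lemma size_grid_approx:
  assumes "0 < \<eta>" "0 < m" "m \<le> k"
  obtains q where "q \<in> size_grid k \<eta>" "q \<le> m" "real m \<le> (1 + \<eta>) * real q"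
proof
  define l where "l = log (1 + \<eta>) (real m)"
  define j where "j = nat \<lfloor>l\<rfloor>"
  define q where "q = nat \<lceil>(1 + \<eta>) ^ j\<rceil>"
  have l: "0 \<le> l" "l \<le> log (1 + \<eta>) (real k)"
    using assms by (auto simp: l_def)
  have j: "real j \<le> l" "l < real j + 1"
    using l(1) by (auto simp: j_def)
  have m: "real m = (1 + \<eta>) powr l"
    using assms by (simp add: l_def)
  have "(1 + \<eta>) ^ j = (1 + \<eta>) powr real j"
    using assms by (simp add: powr_realpow)
  also have "\<dots> \<le> real m" unfolding m using j assms by (intro powr_mono) auto
  finally show "q \<le> m" by (simp add: q_def ceiling_le_iff)
  have "real m \<le> (1 + \<eta>) powr (real j + 1)"
    unfolding m using j assms by (intro powr_mono) auto
  also have "\<dots> = (1 + \<eta>) * (1 + \<eta>) ^ j"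
    using assms by (simp add: powr_add powr_realpow)
  also have "\<dots> \<le> (1 + \<eta>) * real q"
    using assms unfolding q_def by (intro mult_left_mono real_nat_ceiling_ge) auto
  finally show "real m \<le> (1 + \<eta>) * real q" .
  \<comment> \<open>The index range reaches the logarithm of \<open>k\<close>, and the cap at
    \<open>k\<close> is inactive because \<open>q \<le> m \<le> k\<close>.\<close>
  have "j \<le> nat \<lceil>log (1 + \<eta>) (real k)\<rceil>"
    using j(1) l(2) by linarith
  moreover have "min k (nat \<lceil>(1 + \<eta>) ^ j\<rceil>) = q"
    using \<open>q \<le> m\<close> assms by (simp add: q_def)
  ultimately show "q \<in> size_grid k \<eta>"
    unfolding size_grid_def by force
qed

section \<open>Number of budgets in the grid and their sum\<close>

lemma ln_one_plus_ge_half: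
  assumes "0 < \<eta>" "\<eta> \<le> 1"
  shows "\<eta> / 2 \<le> ln (1 + \<eta> :: real)"
proof -
  have "- ln (1 + \<eta>) = ln (1 / (1 + \<eta>))" using assms by (simp add: ln_div)
  also have "\<dots> \<le> 1 / (1 + \<eta>) - 1" using assms by (intro ln_le_minus_one) simp
  also have "\<dots> \<le> - \<eta> / 2" using assms by (simp add: field_simps)
  finally show ?thesis by simp
qed

lemma nat_ceiling_le: "0 \<le> x \<Longrightarrow> real (nat \<lceil>x\<rceil>) \<le> x + 1"
  by linarith

lemma card_size_grid_le:
  assumes "0 < \<eta>" "\<eta> \<le> 1 / 2"
  shows "real (card (size_grid k \<eta>)) \<le> 1 / \<eta> + 2 * ln (real k) / \<eta> + 3"
proof -
  define J where "J = nat \<lceil>log (1 + \<eta>) (real k)\<rceil>"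
  let ?g = "\<lambda>j. min k (nat \<lceil>(1 + \<eta>) ^ j\<rceil>)"
  have "0 \<le> ln (real k)" by (cases k) auto
  have "card (size_grid k \<eta>) \<le> card {1..min k (nat \<lceil>1 / \<eta>\<rceil>)} + card (?g ` {0..J})"
    unfolding size_grid_def J_def by (rule card_Un_le)
  also have "\<dots> \<le> nat \<lceil>1 / \<eta>\<rceil> + (J + 1)"
    using card_image_le[of "{0..J}" ?g] by simp
  finally have "real (card (size_grid k \<eta>)) \<le> real (nat \<lceil>1 / \<eta>\<rceil>) + real J + 1" by linarith
  moreover have "real (nat \<lceil>1 / \<eta>\<rceil>) \<le> 1 / \<eta> + 1"
    using assms by (intro nat_ceiling_le) simp
  moreover have "log (1 + \<eta>) (real k) \<le> ln (real k) / (\<eta> / 2)"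
    unfolding log_def using assms ln_one_plus_ge_half[of \<eta>] \<open>0 \<le> ln (real k)\<close>
    by (intro divide_left_mono) auto
  moreover have "real J \<le> log (1 + \<eta>) (real k) + 1"
    unfolding J_def using assms \<open>0 \<le> ln (real k)\<close>
    by (intro nat_ceiling_le) (simp add: log_def)
  ultimately show ?thesis by (simp add: mult.commute)
qed

text \<open>This will bound the size of the union of all outputs. The initial segment contributes at
  most \<open>M * M\<close>, one factor being at most \<open>k\<close> and the other at most
  \<open>1 / \<eta> + 1\<close>. The powers form a geometric series with last term of order
  \<open>k\<close>, so their sum is of order \<open>k / \<eta>\<close>.\<close>

lemma sum_size_grid_le:
  assumes "0 < \<eta>" "\<eta> \<le> 1 / 8"
  shows "real (\<Sum>(size_grid k \<eta>)) \<le> 5 * real k / \<eta>"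
proof (cases "k = 0")
  case True
  then have "\<Sum>(size_grid k \<eta>) = 0"
    using size_grid_le by (intro sum.neutral) fastforce
  with True show ?thesis by simp
next
  case False
  define J where "J = nat \<lceil>log (1 + \<eta>) (real k)\<rceil>"
  define M where "M = min k (nat \<lceil>1 / \<eta>\<rceil>)"
  let ?g = "\<lambda>j. min k (nat \<lceil>(1 + \<eta>) ^ j\<rceil>)"
  have "real M * real M \<le> real k * (1 / \<eta> + 1)"
  proof (intro mult_mono)
    have "real (nat \<lceil>1 / \<eta>\<rceil>) \<le> 1 / \<eta> + 1"
      using assms by (intro nat_ceiling_le) simp
    then show "real M \<le> 1 / \<eta> + 1" by (simp add: M_def)
  qed (auto simp: M_def)
  also have "\<dots> \<le> real k * (9 / 8 / \<eta>)"
    using assms by (intro mult_left_mono) (auto simp: field_simps)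
  finally have small: "real M * real M \<le> real k * (9 / 8 / \<eta>)" .

  \<comment> \<open>The rounding in \<open>J\<close> and the extra exponent in the geometric sum
    each cost a factor \<open>1 + \<eta> \<le> 9 / 8\<close>.\<close>
  have "real J \<le> log (1 + \<eta>) (real k) + 1"
    unfolding J_def using assms False by (intro nat_ceiling_le) simp
  then have "(1 + \<eta>) powr (real J + 1) \<le> (1 + \<eta>) powr (log (1 + \<eta>) (real k) + 2)"
    using assms by (intro powr_mono) auto
  also have "\<dots> = real k * (1 + \<eta>)\<^sup>2"
    using assms False by (simp add: powr_add)
  also have "\<dots> \<le> real k * (9 / 8)\<^sup>2"
    using assms by (intro mult_left_mono power_mono) auto
  finally have J: "(1 + \<eta>) ^ Suc J \<le> real k * (81 / 64)"
    using assms by (simp add: powr_add powr_realpow power2_eq_square mult.commute)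

  have "real (\<Sum>j\<in>{0..J}. ?g j) \<le> (\<Sum>j\<in>{0..J}. 2 * (1 + \<eta>) ^ j)"
    unfolding of_nat_sum
  proof (rule sum_mono)
    fix j
    \<comment> \<open>As the powers are at least 1, rounding up at most doubles them.\<close>
    have "1 \<le> (1 + \<eta>) ^ j" using assms by (intro one_le_power) simp
    moreover have "real (nat \<lceil>(1 + \<eta>) ^ j\<rceil>) \<le> (1 + \<eta>) ^ j + 1"
      using assms by (intro nat_ceiling_le) simp
    moreover have "real (?g j) \<le> real (nat \<lceil>(1 + \<eta>) ^ j\<rceil>)" by simp
    ultimately show "real (?g j) \<le> 2 * (1 + \<eta>) ^ j" by linarith
  qed
  also have "\<dots> = 2 * (\<Sum>j<Suc J. (1 + \<eta>) ^ j)"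
    by (simp add: sum_distrib_left atLeast0AtMost lessThan_Suc_atMost)
  also have "\<dots> = 2 * (((1 + \<eta>) ^ Suc J - 1) / \<eta>)"
    using assms by (subst geometric_sum) auto
  also have "\<dots> \<le> 2 * (real k * (81 / 64) / \<eta>)"
    using J assms by (intro mult_left_mono divide_right_mono) auto
  finally have large: "real (\<Sum>j\<in>{0..J}. ?g j) \<le> 2 * (real k * (81 / 64) / \<eta>)" .

  have "\<Sum>(size_grid k \<eta>) \<le> \<Sum>{1..M} + \<Sum>(?g ` {0..J})"
    unfolding size_grid_def J_def M_def
    by (subst sum.union_inter[symmetric]) auto
  also have "\<dots> \<le> M * M + (\<Sum>j\<in>{0..J}. ?g j)"
    using sum_bounded_above[of "{1..M}" "\<lambda>i. i" M] sum_image_le[of "{0..J}" "\<lambda>i. i" ?g]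
    by (intro add_mono) auto
  finally have "real (\<Sum>(size_grid k \<eta>)) \<le> real M * real M + real (\<Sum>j\<in>{0..J}. ?g j)"
    by (metis of_nat_add of_nat_le_iff of_nat_mult)
  also have "\<dots> \<le> real k * (9 / 8 / \<eta>) + 2 * (real k * (81 / 64) / \<eta>)"
    using small large by (intro add_mono)
  also have "\<dots> = (9 / 8 + 81 / 32) * real k / \<eta>" by (simp add: field_simps)
  also have "\<dots> \<le> 5 * real k / \<eta>"
    using assms by (intro divide_right_mono mult_right_mono) auto
  finally show ?thesis .
qed

section \<open>Query complexity\<close>

text \<open>\<open>(1 - \<eta>) ^ i \<le> exp (- i * \<eta>)\<close> falls below
  \<open>\<eta> / n\<close> once \<open>i\<close> exceeds \<open>ln (n / \<eta>) / \<eta>\<close>;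
  the floor plus 1 is such an \<open>i\<close>.\<close>

lemma num_passes_le:
  assumes "0 < \<eta>" "\<eta> < 1" "0 < n"
  shows "real (num_passes n \<eta>) \<le> ln (real n / \<eta>) / \<eta> + 1"
proof -
  define i where "i = nat \<lfloor>ln (real n / \<eta>) / \<eta>\<rfloor> + 1"
  have "0 \<le> ln (real n / \<eta>)"
    using assms by (intro ln_ge_zero) (simp add: field_simps)
  then have i: "ln (real n / \<eta>) / \<eta> < real i" "real i \<le> ln (real n / \<eta>) / \<eta> + 1"
    using assms unfolding i_def by (simp, linarith, simp)
  have "(1 - \<eta>) ^ i \<le> exp (- \<eta>) ^ i"
    using assms exp_ge_add_one_self[of "- \<eta>"] by (intro power_mono) auto
  also have "\<dots> = exp (- (real i * \<eta>))" by (simp flip: exp_of_nat_mult)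
  also have "\<dots> < exp (- ln (real n / \<eta>))"
    using i(1) assms by (simp add: field_simps)
  also have "\<dots> = \<eta> / real n"
    using assms by (simp add: exp_minus)
  finally have "num_passes n \<eta> \<le> i"
    unfolding num_passes_def by (rule Least_le)
  with i(2) show ?thesis by linarith
qed

text \<open>One logarithm comes from the number of budgets, the other from the number of passes;
  \<open>513 = 19 * 27\<close> multiplies the constants of the two bounds.\<close>

lemma sum_queries_le:
  assumes n: "length xs = n" and k: "k \<le> n" and \<epsilon>: "0 < \<epsilon>" "\<epsilon> < 1 / 2"
  shows "real (\<Sum>q\<in>size_grid k (\<epsilon> / 4). queries f (threshold_greedy xs q (\<epsilon> / 4)))
           \<le> 513 * (real n / \<epsilon>\<^sup>2) * ln (real n / \<epsilon>) ^ 2"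
proof (cases "n = 0")
  case True
  then show ?thesis
    using queries_threshold_greedy_le[of f xs] n by (simp del: length_0_conv)
next
  case False
  define L where "L = ln (real n / \<epsilon>)"
  let ?p = "num_passes n (\<epsilon> / 4)" and ?K = "size_grid k (\<epsilon> / 4)"
  \<comment> \<open>This keeps \<open>L\<close> away from 0, so that additive constants can be
    absorbed into multiples of \<open>L / \<epsilon>\<close>.\<close>
  have "(2::real) \<le> real n / \<epsilon>" using False \<epsilon> by (simp add: field_simps)
  then have ln2: "ln 2 \<le> L" unfolding L_def by (intro ln_mono) auto
  have L: "1 / 2 \<le> L" using ln2 ln_one_plus_ge_half[of 1] by simp
  have one: "1 \<le> L / \<epsilon>" using L \<epsilon> by (simp add: field_simps)
  have inv: "1 / (\<epsilon> / 4) \<le> 8 * (L / \<epsilon>)" using L \<epsilon> by (simp add: field_simps)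

  have "ln (real n / (\<epsilon> / 4)) = ln (4 * (real n / \<epsilon>))" by (simp add: mult.commute)
  also have "\<dots> = ln (2 * 2) + L" using False \<epsilon> unfolding L_def by (subst ln_mult) auto
  also have "\<dots> = ln 2 + ln 2 + L" by (subst ln_mult) auto
  finally have "ln (real n / (\<epsilon> / 4)) \<le> 3 * L" using ln2 by simp
  then have "ln (real n / (\<epsilon> / 4)) / (\<epsilon> / 4) \<le> 3 * L / (\<epsilon> / 4)"
    using \<epsilon> by (intro divide_right_mono) auto
  also have "\<dots> = 12 * (L / \<epsilon>)" by simp
  finally have "ln (real n / (\<epsilon> / 4)) / (\<epsilon> / 4) + 1 \<le> 13 * (L / \<epsilon>)"
    using one by simp
  moreover have "real ?p \<le> ln (real n / (\<epsilon> / 4)) / (\<epsilon> / 4) + 1"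
    using False \<epsilon> by (intro num_passes_le) auto
  ultimately have passes: "real ?p \<le> 13 * (L / \<epsilon>)" by (rule order.trans[rotated])

  have "queries f (threshold_greedy xs q (\<epsilon> / 4)) \<le> n + ?p * (n * 2)" for q
    using queries_threshold_greedy_le[of f xs q "\<epsilon> / 4"] n by simp
  then have "(\<Sum>q\<in>?K. queries f (threshold_greedy xs q (\<epsilon> / 4)))
      \<le> card ?K * (n + ?p * (n * 2))"
    using sum_bounded_above[of ?K "\<lambda>q. queries f (threshold_greedy xs q (\<epsilon> / 4))"] by simp
  then have "real (\<Sum>q\<in>?K. queries f (threshold_greedy xs q (\<epsilon> / 4)))
      \<le> real (card ?K * (n + ?p * (n * 2)))"
    by (rule of_nat_mono)
  also have "\<dots> = real (card ?K) * (real n * (1 + 2 * real ?p))"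
    by (simp add: algebra_simps)
  \<comment> \<open>\<open>19 = 8 + 8 + 3\<close> collects the terms of
    \<open>card_size_grid_le\<close>, and \<open>27 = 1 + 2 * 13\<close> comes from
    \<open>passes\<close>.\<close>
  also have "\<dots> \<le> (19 * (L / \<epsilon>)) * (real n * (27 * (L / \<epsilon>)))"
  proof (intro mult_mono)
    have "ln (real k) \<le> L"
    proof (cases "k = 0")
      case False
      then have "real k * \<epsilon> \<le> real n * 1" using k \<epsilon> by (intro mult_mono) auto
      then show ?thesis
        unfolding L_def using False \<epsilon> by (intro ln_mono) (auto simp: field_simps)
    qed (use L in simp)
    then have "2 * ln (real k) / (\<epsilon> / 4) \<le> 2 * L / (\<epsilon> / 4)"
      using \<epsilon> by (intro divide_right_mono) auto
    also have "\<dots> = 8 * (L / \<epsilon>)" by simp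
    finally have k_term: "2 * ln (real k) / (\<epsilon> / 4) \<le> 8 * (L / \<epsilon>)" .
    have "real (card ?K) \<le> 1 / (\<epsilon> / 4) + 2 * ln (real k) / (\<epsilon> / 4) + 3"
      using \<epsilon> by (intro card_size_grid_le) auto
    also have "\<dots> \<le> 8 * (L / \<epsilon>) + 8 * (L / \<epsilon>) + 3 * (L / \<epsilon>)"
      using inv k_term one by (intro add_mono) auto
    finally show "real (card ?K) \<le> 19 * (L / \<epsilon>)" by simp
  qed (use passes one in auto)
  also have "\<dots> = 513 * (real n / \<epsilon>\<^sup>2) * L ^ 2"
    by (simp add: power2_eq_square)
  finally show ?thesis unfolding L_def .
qed

text \<open>The constants are chosen before all data, hence absolute; the power of
  \<open>ln (n / \<epsilon>)\<close> spells out the logarithmic factors hidden by the soft-O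
  notation.\<close>

theorem theorem6:
  "\<exists>(C\<^sub>1::real) (C\<^sub>2::real) (c::nat).
     \<forall>(N::'a set) (xs::'a list) (f::'a set \<Rightarrow> real) (n::nat) (k::nat) (\<epsilon>::real).
       finite N \<longrightarrow> card N = n \<longrightarrow> distinct xs \<longrightarrow> set xs = N \<longrightarrow>
       (\<forall>A\<subseteq>N. 0 \<le> f A) \<longrightarrow> mono_on (Pow N) f \<longrightarrow> submodular_on N f \<longrightarrow>
       k \<le> n \<longrightarrow> 0 < \<epsilon> \<longrightarrow> \<epsilon> < 1 / 2 \<longrightarrow>
       (let \<eta> = \<epsilon> / 4;
            K = size_grid k \<eta>;
            P = (\<Union>q\<in>K. result f (threshold_greedy xs q \<eta>))
        in real (card P) \<le> C\<^sub>1 * (real k / \<epsilon>) \<and>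
           real (\<Sum>q\<in>K. queries f (threshold_greedy xs q \<eta>))
             \<le> C\<^sub>2 * (real n / \<epsilon>\<^sup>2) * ln (real n / \<epsilon>) ^ c \<and>
           (\<forall>k'\<le>k. \<exists>Q\<subseteq>P. card Q \<le> k' \<and>
              f Q \<ge> (1 - 1 / exp 1 - \<epsilon>) * OPT N f k'))"
\<comment> \<open>\<open>20 = 5 * 4\<close>, from \<open>sum_size_grid_le\<close> and
  \<open>\<eta> = \<epsilon> / 4\<close>.\<close>
proof (rule exI[of _ 20], rule exI[of _ 513], rule exI[of _ 2], intro allI impI)
  fix N :: "'a set" and xs :: "'a list" and f :: "'a set \<Rightarrow> real" and n k :: nat and \<epsilon> :: real
  assume N: "finite N" "card N = n" and xs: "distinct xs" "set xs = N"
    and f: "\<forall>A\<subseteq>N. 0 \<le> f A" "mono_on (Pow N) f" "submodular_on N f"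
    and k: "k \<le> n" and \<epsilon>: "0 < \<epsilon>" "\<epsilon> < 1 / 2"
  define \<eta> where "\<eta> = \<epsilon> / 4"
  define K where "K = size_grid k \<eta>"
  define S where "S = (\<lambda>q. result f (threshold_greedy xs q \<eta>))"
  interpret monotone_submodular N f using N f by unfold_locales auto
  have \<eta>: "0 < \<eta>" "\<eta> \<le> 1 / 8" using \<epsilon> by (auto simp: \<eta>_def)
  have len: "length xs = n" using xs N distinct_card by force

  have card_S: "card (S q) \<le> q" for q
    unfolding S_def by (rule card_threshold_greedy_le)
  have "card (\<Union>q\<in>K. S q) \<le> (\<Sum>q\<in>K. card (S q))"
    unfolding K_def by (intro card_UN_le finite_size_grid)
  also have "\<dots> \<le> \<Sum>K" by (intro sum_mono card_S)
  finally have "real (card (\<Union>q\<in>K. S q)) \<le> real (\<Sum>K)" by (rule of_nat_mono)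
  also have "\<dots> \<le> 5 * real k / \<eta>"
    unfolding K_def using \<eta> by (rule sum_size_grid_le)
  also have "\<dots> \<le> 20 * (real k / \<epsilon>)"
    using \<epsilon> by (simp add: \<eta>_def field_simps)
  finally have size: "real (card (\<Union>q\<in>K. S q)) \<le> 20 * (real k / \<epsilon>)" .

  have approx: "\<exists>Q\<subseteq>(\<Union>q\<in>K. S q). card Q \<le> k' \<and> f Q \<ge> (1 - 1 / exp 1 - \<epsilon>) * OPT N f k'"
    if "k' \<le> k" for k'
  proof (cases "k' = 0")
    \<comment> \<open>\<open>size_grid_approx\<close> covers positive sizes only; for size 0 the
      empty set is the only competitor, and it serves as \<open>Q\<close>.\<close>
    case True
    obtain O' where O': "O' \<subseteq> N" "card O' \<le> k'" "f O' = OPT N f k'"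
      by (rule OPT_attained[of k'])
    then have "O' = {}" using True finite_subset[OF O'(1) N(1)] by simp
    moreover have "(1 - 1 / exp 1 - \<epsilon>) * f {} \<le> 1 * f {}"
    proof (rule mult_right_mono)
      show "1 - 1 / exp 1 - \<epsilon> \<le> 1" using \<epsilon> inverse_exp_nonneg[of 1] by linarith
    qed (simp add: nonneg)
    ultimately show ?thesis using O' by (intro exI[of _ "{}"]) auto
  next
    case False
    then obtain q where q: "q \<in> K" "q \<le> k'" "real k' \<le> (1 + \<eta>) * real q"
      using size_grid_approx[of \<eta> k' k] \<eta> \<open>k' \<le> k\<close> unfolding K_def by blast
    have "(1 - 1 / exp 1 - 4 * \<eta>) * OPT N f k' \<le> f (S q)"
      unfolding S_def using xs False that k N q \<eta> by (intro threshold_greedy_approx) auto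
    then show ?thesis
      using q card_S[of q] by (intro exI[of _ "S q"]) (auto simp: \<eta>_def)
  qed

  show "let \<eta> = \<epsilon> / 4; K = size_grid k \<eta>;
          P = (\<Union>q\<in>K. result f (threshold_greedy xs q \<eta>))
        in real (card P) \<le> 20 * (real k / \<epsilon>) \<and>
           real (\<Sum>q\<in>K. queries f (threshold_greedy xs q \<eta>))
             \<le> 513 * (real n / \<epsilon>\<^sup>2) * ln (real n / \<epsilon>) ^ 2 \<and>
           (\<forall>k'\<le>k. \<exists>Q\<subseteq>P. card Q \<le> k' \<and>
              f Q \<ge> (1 - 1 / exp 1 - \<epsilon>) * OPT N f k')"
    using size approx sum_queries_le[OF len k \<epsilon>, of f]
    unfolding K_def S_def \<eta>_def Let_def by blast
qed

end
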